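(* The coefficient field of a convergent Weierstraß system is real closed.
   Context: For $n\ge0$ let $\mathcal{O}_n$ be the ring of real power series in $X=(X_1,\dots,X_n)$ converging near $0$ ($\mathcal{O}_0=\mathbb{R}$), identified with a subring of $\mathcal{O}_{n+1}$. For $f\in\mathcal{O}_n$ let $\mathcal{D}(f)$ be the union of all boxes $\prod_i]-R_i,R_i[$ ($R_i\in(0,\infty]$) on which $f$ converges absolutely; for $a\in\mathcal{D}(f)$, $f_a$ is the expansion at $0$ of $x\mapsto f(a+x)$; for a subfield $k\subset\mathbb{R}$, $k\{X\}$ denotes the elements of $\mathcal{O}_n$ with coefficients in $k$. A system is a sequence $\mathcal{S}=(\mathcal{S}_n)_{n\ge0}$, $\mathcal{S}_n\subset\mathcal{O}_n$, such that each $\mathcal{S}_n$ is a subring of $\mathcal{O}_n$, $\mathcal{S}_n=\mathcal{S}_{n+1}\cap\mathcal{O}_n$, $\mathcal{S}_n$ is closed under permuting variables, $k:=\mathcal{S}_0$ is a subfield of $\mathbb{R}$ (the coefficient field), and $k[X]\subset\mathcal{S}_n\subset k\{X\}$ for $n\ge1$. It is convergent if $f_a\in\mathcal{S}_n$ for all $n$, $f\in\mathcal{S}_n$, $a\in\mathcal{D}(f)\cap k^n$. A convergent system is a convergent Weierstraß system if for every $n\ge1$: whenever $f\in\mathcal{S}_n$ is regular in $X_n$ of order $d$ (i.e. $f(0,\dots,0,X_n)$ has zero coefficients at $X_n^j$ for $j<d$ and nonzero coefficient at $X_n^d$) and $g\in\mathcal{S}_n$, there are $h\in\mathcal{S}_n$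 and $r\in\mathcal{S}_{n-1}[X_n]$ of degree $<d$ in $X_n$ with $g=fh+r$. *)

theory Defs
  imports
    "HOL-Library.Poly_Mapping"
    "HOL-Library.Extended_Real"
    "HOL-Combinatorics.Permutations"
    "HOL-Computational_Algebra.Polynomial"
    "HOL-Analysis.Infinite_Sum"
begin

text \<open>
  Formal power series over the reals in the variables \<open>X\<^sub>1, X\<^sub>2, \<dots>\<close>, the variable \<open>X\<^sub>i\<^sub>+\<^sub>1\<close> having
  index \<open>i\<close>.  A monomial is its finitely supported exponent vector.  Series in \<open>n\<close> variables are
  those involving only the variables of index below \<open>n\<close>, so that the identification of series in
  \<open>n\<close> variables with series in \<open>n + 1\<close> variables is a plain inclusion of sets.
\<close>

typedef mps = "UNIV :: ((nat \<Rightarrow>\<^sub>0 nat) \<Rightarrow> real) set"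
  morphisms mps_nth Abs_mps ..

setup_lifting type_definition_mps

lemma mps_eqI: "(\<And>m. mps_nth f m = mps_nth g m) \<Longrightarrow> f = g"
  by transfer auto

lemma finite_monom_splits: "finite {(p, q). p + q = (m :: nat \<Rightarrow>\<^sub>0 nat)}"
proof -
  let ?K = "Poly_Mapping.keys m"
  let ?B = "{..Max (insert 0 (Poly_Mapping.lookup m ` ?K))}"
  let ?F = "{f. \<forall>i. (i \<in> ?K \<longrightarrow> f i \<in> ?B) \<and> (i \<notin> ?K \<longrightarrow> f i = (0 :: nat))}"
  let ?P = "{p. \<forall>i. Poly_Mapping.lookup p i \<le> Poly_Mapping.lookup m i}"
  have "finite ?F"
    by (rule finite_set_of_finite_funs) auto
  moreover have "Poly_Mapping.lookup ` ?P \<subseteq> ?F"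
  proof clarify
    fix p :: "nat \<Rightarrow>\<^sub>0 nat" and i
    assume p: "\<forall>i. Poly_Mapping.lookup p i \<le> Poly_Mapping.lookup m i"
    have "i \<in> ?K \<Longrightarrow> Poly_Mapping.lookup m i \<le> Max (insert 0 (Poly_Mapping.lookup m ` ?K))"
      by (rule Max_ge) auto
    moreover have "i \<notin> ?K \<Longrightarrow> Poly_Mapping.lookup m i = 0"
      by (simp add: in_keys_iff)
    ultimately show "(i \<in> ?K \<longrightarrow> Poly_Mapping.lookup p i \<in> ?B) \<and>
        (i \<notin> ?K \<longrightarrow> Poly_Mapping.lookup p i = 0)"
      using p by (metis atMost_iff le_trans le_zero_eq)
  qed
  ultimately have "finite (Poly_Mapping.lookup ` ?P)"
    by (rule rev_finite_subset)
  then have "finite ?P"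
    by (rule finite_imageD) (auto intro: inj_onI poly_mapping_eqI)
  then have "finite (?P \<times> ?P)"
    by blast
  moreover have "{(p, q). p + q = m} \<subseteq> ?P \<times> ?P"
    by (auto simp: Poly_Mapping.lookup_add)
  ultimately show ?thesis
    by (rule rev_finite_subset)
qed

instantiation mps :: comm_ring_1
begin

lift_definition zero_mps :: mps is "\<lambda>m. 0" .
lift_definition one_mps :: mps is "\<lambda>m. if m = 0 then 1 else 0" .
lift_definition plus_mps :: "mps \<Rightarrow> mps \<Rightarrow> mps" is "\<lambda>f g m. f m + g m" .
lift_definition minus_mps :: "mps \<Rightarrow> mps \<Rightarrow> mps" is "\<lambda>f g m. f m - g m" .
lift_definition uminus_mps :: "mps \<Rightarrow> mps" is "\<lambda>f m. - f m" .
lift_definition times_mps :: "mps \<Rightarrow> mps \<Rightarrow> mps" is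
  "\<lambda>f g m. \<Sum>(p, q) \<in> {(p, q). p + q = m}. f p * g q" .

instance
proof
  fix a b c :: mps
  show "a * b * c = a * (b * c)"
  proof (transfer, rule ext)
    fix a b c :: "(nat \<Rightarrow>\<^sub>0 nat) \<Rightarrow> real" and m
    let ?S = "\<lambda>m :: nat \<Rightarrow>\<^sub>0 nat. {(p, q). p + q = m}"
    have "(\<Sum>(p, q) \<in> ?S m. (\<Sum>(u, v) \<in> ?S p. a u * b v) * c q) =
        (\<Sum>x \<in> ?S m. \<Sum>y \<in> ?S (fst x). a (fst y) * b (snd y) * c (snd x))"
      by (simp add: case_prod_beta sum_distrib_right)
    also have "\<dots> = (\<Sum>(x, y) \<in> Sigma (?S m) (\<lambda>x. ?S (fst x)). a (fst y) * b (snd y) * c (snd x))"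
      by (rule sum.Sigma) (use finite_monom_splits in auto)
    also have "\<dots> = (\<Sum>(x, y) \<in> Sigma (?S m) (\<lambda>x. ?S (snd x)). a (fst x) * (b (fst y) * c (snd y)))"
      by (rule sum.reindex_bij_witness
            [where i = "\<lambda>((p, q), (u, v)). ((p + u, v), (p, u))"
               and j = "\<lambda>((p, q), (u, v)). ((u, v + q), (v, q))"])
         (auto simp: add.assoc mult.assoc)
    also have "\<dots> = (\<Sum>x \<in> ?S m. \<Sum>y \<in> ?S (snd x). a (fst x) * (b (fst y) * c (snd y)))"
      by (rule sum.Sigma [symmetric]) (use finite_monom_splits in auto)
    also have "\<dots> = (\<Sum>(p, q) \<in> ?S m. a p * (\<Sum>(u, v) \<in> ?S q. b u * c v))"
      by (simp add: case_prod_beta sum_distrib_left)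
    finally show "(\<Sum>(p, q) \<in> ?S m. (\<Sum>(u, v) \<in> ?S p. a u * b v) * c q) =
        (\<Sum>(p, q) \<in> ?S m. a p * (\<Sum>(u, v) \<in> ?S q. b u * c v))" .
  qed
  show "a * b = b * a"
    by (transfer, rule ext,
        rule sum.reindex_bij_witness [where i = prod.swap and j = prod.swap])
       (auto simp: add.commute mult.commute)
  show "1 * a = a"
  proof (transfer, rule ext)
    fix a :: "(nat \<Rightarrow>\<^sub>0 nat) \<Rightarrow> real" and m :: "nat \<Rightarrow>\<^sub>0 nat"
    have "(\<Sum>(p, q) \<in> {(p, q). p + q = m}. (if p = 0 then 1 else 0) * a q) =
        (\<Sum>(p, q) \<in> {(0 :: nat \<Rightarrow>\<^sub>0 nat, m)}. (if p = 0 then 1 else 0) * a q)"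
      by (rule sum.mono_neutral_right) (use finite_monom_splits in \<open>auto split: if_splits\<close>)
    then show "(\<Sum>(p, q) \<in> {(p, q). p + q = m}. (if p = 0 then 1 else 0) * a q) = a m"
      by simp
  qed
  show "(a + b) * c = a * c + b * c"
    by transfer (simp add: case_prod_beta distrib_right sum.distrib)
  show "(0 :: mps) \<noteq> 1"
    by transfer (metis zero_neq_one)
qed (transfer; simp add: fun_eq_iff algebra_simps)+

end

lift_definition mps_const :: "real \<Rightarrow> mps" is "\<lambda>c m. if m = 0 then c else 0" .

lift_definition mps_var :: "nat \<Rightarrow> mps" is
  "\<lambda>i m. if m = Poly_Mapping.single i 1 then 1 else 0" .

definition mps_permute :: "(nat \<Rightarrow> nat) \<Rightarrow> mps \<Rightarrow> mps" where
  "mps_permute \<pi> f = Abs_mps (\<lambda>m. mps_nth f (Poly_Mapping.map_key \<pi> m))"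

definition in_vars :: "nat \<Rightarrow> mps \<Rightarrow> bool" where
  "in_vars n f \<longleftrightarrow> (\<forall>m. mps_nth f m \<noteq> 0 \<longrightarrow> Poly_Mapping.keys m \<subseteq> {..<n})"

text \<open>\<open>\<real>\<^sup>n\<close> is realised as the set of sequences vanishing from index \<open>n\<close> on.\<close>

definition real_space :: "nat \<Rightarrow> (nat \<Rightarrow> real) set" where
  "real_space n = {x. \<forall>i\<ge>n. x i = 0}"

definition open_box :: "nat \<Rightarrow> (nat \<Rightarrow> ereal) \<Rightarrow> (nat \<Rightarrow> real) set" where
  "open_box n R = {x \<in> real_space n. \<forall>i<n. - R i < ereal (x i) \<and> ereal (x i) < R i}"

definition mps_term :: "mps \<Rightarrow> (nat \<Rightarrow> real) \<Rightarrow> (nat \<Rightarrow>\<^sub>0 nat) \<Rightarrow> real" where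
  "mps_term f x m = mps_nth f m * (\<Prod>i\<in>Poly_Mapping.keys m. x i ^ Poly_Mapping.lookup m i)"

definition mps_eval :: "mps \<Rightarrow> (nat \<Rightarrow> real) \<Rightarrow> real" where
  "mps_eval f x = infsum (mps_term f x) UNIV"

definition mps_domain :: "nat \<Rightarrow> mps \<Rightarrow> (nat \<Rightarrow> real) set" where
  "mps_domain n f =
     \<Union> {open_box n R | R. (\<forall>i<n. 0 < R i) \<and> (\<forall>x\<in>open_box n R. mps_term f x abs_summable_on UNIV)}"

definition conv_series :: "nat \<Rightarrow> mps set" where
  "conv_series n = {f. in_vars n f \<and>
     (\<exists>r::real. 0 < r \<and> (\<forall>x\<in>open_box n (\<lambda>_. ereal r). mps_term f x abs_summable_on UNIV))}"

definition mps_expand :: "nat \<Rightarrow> mps \<Rightarrow> (nat \<Rightarrow> real) \<Rightarrow> mps" where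
  "mps_expand n f a = (THE g. g \<in> conv_series n \<and>
     (\<exists>r::real. 0 < r \<and>
        (\<forall>x\<in>open_box n (\<lambda>_. ereal r). mps_eval g x = mps_eval f (\<lambda>i. a i + x i))))"

definition coeffs_in :: "real set \<Rightarrow> mps \<Rightarrow> bool" where
  "coeffs_in k f \<longleftrightarrow> (\<forall>m. mps_nth f m \<in> k)"

definition conv_series_over :: "real set \<Rightarrow> nat \<Rightarrow> mps set" where
  "conv_series_over k n = {f \<in> conv_series n. coeffs_in k f}"

definition polys_over :: "real set \<Rightarrow> nat \<Rightarrow> mps set" where
  "polys_over k n = {f. in_vars n f \<and> coeffs_in k f \<and> finite {m. mps_nth f m \<noteq> 0}}"

definition is_subring :: "'a::comm_ring_1 set \<Rightarrow> bool" where
  "is_subring A \<longleftrightarrow> 0 \<in> A \<and> 1 \<in> A \<and> (\<forall>x\<in>A. - x \<in> A) \<and>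
     (\<forall>x\<in>A. \<forall>y\<in>A. x + y \<in> A) \<and> (\<forall>x\<in>A. \<forall>y\<in>A. x * y \<in> A)"

definition is_subfield :: "'a::field set \<Rightarrow> bool" where
  "is_subfield k \<longleftrightarrow> is_subring k \<and> (\<forall>x\<in>k. x \<noteq> 0 \<longrightarrow> inverse x \<in> k)"

text \<open>Real closedness of a subfield, regarded as an ordered field with the induced ordering.\<close>

definition real_closed :: "'a::linordered_field set \<Rightarrow> bool" where
  "real_closed k \<longleftrightarrow> is_subfield k \<and>
     (\<forall>a\<in>k. 0 \<le> a \<longrightarrow> (\<exists>b\<in>k. a = b\<^sup>2)) \<and>
     (\<forall>p. (\<forall>i. poly.coeff p i \<in> k) \<and> odd (degree p) \<longrightarrow> (\<exists>x\<in>k. poly p x = 0))"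

definition coeff_field :: "(nat \<Rightarrow> mps set) \<Rightarrow> real set" where
  "coeff_field S = {c. mps_const c \<in> S 0}"

definition is_system :: "(nat \<Rightarrow> mps set) \<Rightarrow> bool" where
  "is_system S \<longleftrightarrow>
     (\<forall>n. S n \<subseteq> conv_series n \<and> is_subring (S n)) \<and>
     (\<forall>n. S n = S (Suc n) \<inter> conv_series n) \<and>
     (\<forall>n \<pi> f. \<pi> permutes {..<n} \<longrightarrow> f \<in> S n \<longrightarrow> mps_permute \<pi> f \<in> S n) \<and>
     is_subfield (coeff_field S) \<and>
     (\<forall>n\<ge>1. polys_over (coeff_field S) n \<subseteq> S n \<and> S n \<subseteq> conv_series_over (coeff_field S) n)"

definition convergent_system :: "(nat \<Rightarrow> mps set) \<Rightarrow> bool" where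
  "convergent_system S \<longleftrightarrow> is_system S \<and>
     (\<forall>n. \<forall>f\<in>S n. \<forall>a\<in>mps_domain n f.
        (\<forall>i<n. a i \<in> coeff_field S) \<longrightarrow> mps_expand n f a \<in> S n)"

text \<open>The last of the first \<open>n\<close> variables has index \<open>n - 1\<close>.\<close>

definition regular_of_order :: "nat \<Rightarrow> mps \<Rightarrow> nat \<Rightarrow> bool" where
  "regular_of_order n f d \<longleftrightarrow>
     (\<forall>j<d. mps_nth f (Poly_Mapping.single (n - 1) j) = 0) \<and>
     mps_nth f (Poly_Mapping.single (n - 1) d) \<noteq> 0"

definition polys_in_last_var :: "(nat \<Rightarrow> mps set) \<Rightarrow> nat \<Rightarrow> nat \<Rightarrow> mps set" where
  "polys_in_last_var S n d =
     {\<Sum>j<d. c j * mps_var (n - 1) ^ j | c. \<forall>j<d. c j \<in> S (n - 1)}"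

definition convergent_weierstrass_system :: "(nat \<Rightarrow> mps set) \<Rightarrow> bool" where
  "convergent_weierstrass_system S \<longleftrightarrow> convergent_system S \<and>
     (\<forall>n\<ge>1. \<forall>f\<in>S n. \<forall>d. regular_of_order n f d \<longrightarrow>
        (\<forall>g\<in>S n. \<exists>h\<in>S n. \<exists>r\<in>polys_in_last_var S n d. g = f * h + r))"

end

theory Submission
  imports Defs "HOL-Complex_Analysis.Complex_Analysis"
begin

text \<open>
  The coefficient field \<open>k\<close> is in fact algebraically closed in the reals.  Let \<open>\<alpha>\<close> be a real root of a
  polynomial over \<open>k\<close>, without loss of generality a simple root of \<open>p\<close>.  For a rational \<open>b\<close> near \<open>\<alpha>\<close>
  put \<open>q(Y) = p(b + Y) - p(b)\<close>.  Weierstrass division of \<open>X\<^sub>2\<close> by \<open>q(X\<^sub>2) - X\<^sub>1\<close>, which is regular of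
  order 1, leaves a remainder \<open>r\<close> in \<open>S\<^sub>1\<close> that is the compositional inverse of \<open>q\<close>.  Its radius of
  convergence is bounded below independently of \<open>b\<close>, because \<open>r(x) = G(p(b) + x) - b\<close> for a
  holomorphic local inverse \<open>G\<close> of \<open>p\<close> at \<open>\<alpha>\<close>.  Hence \<open>-p(b)\<close> lies in the domain of \<open>r\<close> once \<open>b\<close> is
  close enough to \<open>\<alpha>\<close>, and \<open>r(-p(b)) = \<alpha> - b\<close> is the constant coefficient of the expansion of \<open>r\<close> at
  \<open>-p(b)\<close>, so it belongs to \<open>k\<close>.
\<close>

subsection \<open>Evaluation of multivariate power series\<close>

lemma prod_keys_add:
  fixes x :: "nat \<Rightarrow> real" and p q :: "nat \<Rightarrow>\<^sub>0 nat"
  shows "(\<Prod>i\<in>Poly_Mapping.keys (p + q). x i ^ Poly_Mapping.lookup (p + q) i) =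
    (\<Prod>i\<in>Poly_Mapping.keys p. x i ^ Poly_Mapping.lookup p i) *
    (\<Prod>i\<in>Poly_Mapping.keys q. x i ^ Poly_Mapping.lookup q i)"
proof -
  let ?K = "Poly_Mapping.keys p \<union> Poly_Mapping.keys q"
  \<comment> \<open>Both supports are enlarged to a common one; the added exponents are 0 and
    contribute factors 1.\<close>
  have ext: "(\<Prod>i\<in>Poly_Mapping.keys m. x i ^ Poly_Mapping.lookup m i) =
      (\<Prod>i\<in>?K. x i ^ Poly_Mapping.lookup m i)" if "Poly_Mapping.keys m \<subseteq> ?K" for m
    by (rule prod.mono_neutral_left) (use that in \<open>auto simp: in_keys_iff\<close>)
  have "Poly_Mapping.keys (p + q) \<subseteq> ?K"
    by (rule Poly_Mapping.keys_add)
  from ext[OF this] show ?thesis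
    unfolding ext[OF Un_upper1] ext[OF Un_upper2]
    by (simp add: Poly_Mapping.lookup_add power_add prod.distrib)
qed

text \<open>Unconditional summability of reals is absolute, so the products of the norms are
  summable over \<open>A \<times> B\<close>. Absolute summability of the product family then allows
  the sum to be computed iteratively.\<close>

lemma has_sum_times:
  fixes f :: "'a \<Rightarrow> real" and g :: "'b \<Rightarrow> real"
  assumes f: "(f has_sum s) A" and g: "(g has_sum t) B"
  shows "((\<lambda>(a, b). f a * g b) has_sum s * t) (A \<times> B)"
proof (rule has_sum_SigmaI)
  show "((\<lambda>y. case (x, y) of (a, b) \<Rightarrow> f a * g b) has_sum f x * t) B" for x
    using has_sum_cmult_right[OF g] by simp
  show "((\<lambda>x. f x * t) has_sum s * t) A"
    using has_sum_cmult_left[OF f] by simp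
  have "(\<lambda>a. norm (f a)) summable_on A" "(\<lambda>b. norm (g b)) summable_on B"
    unfolding summable_on_iff_abs_summable_on_real[symmetric]
    using f g by (auto simp: summable_on_def)
  then obtain u where u: "((\<lambda>b. norm (g b)) has_sum u) B"
    and fa: "(\<lambda>a. norm (f a)) summable_on A"
    by (auto simp: summable_on_def)
  have "(\<lambda>(a, b). norm (f a) * norm (g b)) summable_on A \<times> B"
  proof (rule summable_on_SigmaI)
    show "((\<lambda>y. case (x, y) of (a, b) \<Rightarrow> norm (f a) * norm (g b)) has_sum norm (f x) * u) B" for x
      using has_sum_cmult_right[OF u] by simp
    show "(\<lambda>x. norm (f x) * u) summable_on A"
      using fa by (rule summable_on_cmult_left)
  qed auto
  then have "(\<lambda>z. norm (case z of (a, b) \<Rightarrow> f a * g b)) summable_on A \<times> B"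
    by (simp add: case_prod_unfold abs_mult)
  then show "(\<lambda>(a, b). f a * g b) summable_on A \<times> B"
    unfolding summable_on_iff_abs_summable_on_real[symmetric] .
qed

text \<open>This is the Cauchy product: the double sum over exponent pairs is regrouped by the total
  exponent \<open>p + q\<close>, and each group is finite.\<close>

lemma mps_term_has_sum_times:
  assumes f: "(mps_term f x has_sum s) UNIV" and g: "(mps_term g x has_sum t) UNIV"
  shows "(mps_term (f * g) x has_sum s * t) UNIV"
proof -
  let ?S = "\<lambda>m :: nat \<Rightarrow>\<^sub>0 nat. {(p, q). p + q = m}"
  have "((\<lambda>(p, q). mps_term f x p * mps_term g x q) has_sum s * t) (UNIV \<times> UNIV)"
    by (rule has_sum_times[OF f g])
  then have "((\<lambda>(m, p, q). mps_term f x p * mps_term g x q) has_sum s * t) (Sigma UNIV ?S)"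
    by (rule iffD1[OF has_sum_reindex_bij_witness
          [where i = snd and j = "\<lambda>(p, q). (p + q, p, q)"], rotated -1]) auto
  moreover have "((\<lambda>y. case (m, y) of (m, p, q) \<Rightarrow> mps_term f x p * mps_term g x q)
      has_sum mps_term (f * g) x m) (?S m)" for m
  proof (rule has_sum_finiteI[OF finite_monom_splits])
    show "mps_term (f * g) x m =
        (\<Sum>y\<in>?S m. case (m, y) of (m, p, q) \<Rightarrow> mps_term f x p * mps_term g x q)"
      unfolding mps_term_def times_mps.rep_eq sum_distrib_right
      by (rule sum.cong) (auto simp: prod_keys_add)
  qed
  ultimately show ?thesis
    by (rule has_sum_SigmaD)
qed

lemma mps_term_has_sum_add:
  assumes "(mps_term f x has_sum s) UNIV" "(mps_term g x has_sum t) UNIV"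
  shows "(mps_term (f + g) x has_sum s + t) UNIV"
proof -
  have "mps_term (f + g) x = (\<lambda>m. mps_term f x m + mps_term g x m)"
    by (auto simp: mps_term_def plus_mps.rep_eq algebra_simps)
  then show ?thesis
    using has_sum_add[OF assms] by simp
qed

text \<open>The series \<open>\<Sum>n. c n * X^n\<close> in the variable of index \<open>i\<close>.
  Since \<open>single i 0 = 0\<close>, the constant term \<open>c 0\<close> needs no separate case.
  This is the bridge between \<open>mps\<close> and coefficient sequences.\<close>

definition mps_univar :: "nat \<Rightarrow> (nat \<Rightarrow> real) \<Rightarrow> mps" where
  "mps_univar i c = Abs_mps (\<lambda>m. if m \<in> range (Poly_Mapping.single i)
     then c (Poly_Mapping.lookup m i) else 0)"

lemma mps_nth_univar:
  "mps_nth (mps_univar i c) m =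
    (if m \<in> range (Poly_Mapping.single i) then c (Poly_Mapping.lookup m i) else 0)"
  by (simp add: mps_univar_def Abs_mps_inverse)

lemma mps_nth_univar_single [simp]: "mps_nth (mps_univar i c) (Poly_Mapping.single i n) = c n"
  by (simp add: mps_nth_univar)

text \<open>Terms outside \<open>range (single i)\<close> vanish and \<open>single i\<close> is
  injective, so summing over monomials amounts to summing over exponents.\<close>

lemma mps_term_univar_has_sum_iff:
  "(mps_term (mps_univar i c) x has_sum s) UNIV \<longleftrightarrow> ((\<lambda>n. c n * x i ^ n) has_sum s) UNIV"
proof -
  let ?s = "Poly_Mapping.single i :: nat \<Rightarrow> nat \<Rightarrow>\<^sub>0 nat"
  have "(mps_term (mps_univar i c) x has_sum s) UNIV \<longleftrightarrow>
      (mps_term (mps_univar i c) x has_sum s) (range ?s)"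
    by (rule has_sum_cong_neutral) (auto simp: mps_term_def mps_nth_univar)
  also have "\<dots> \<longleftrightarrow> ((mps_term (mps_univar i c) x \<circ> ?s) has_sum s) UNIV"
    by (rule has_sum_reindex) (auto intro: inj_single)
  also have "mps_term (mps_univar i c) x \<circ> ?s = (\<lambda>n. c n * x i ^ n)"
    by (auto simp: mps_term_def fun_eq_iff)
  finally show ?thesis .
qed

lemma mps_term_univar_summable_iff:
  "mps_term (mps_univar i c) x summable_on UNIV \<longleftrightarrow> summable (\<lambda>n. norm (c n * x i ^ n))"
proof -
  have "mps_term (mps_univar i c) x summable_on UNIV \<longleftrightarrow>
      (\<lambda>n. norm (c n * x i ^ n)) summable_on UNIV"
    unfolding summable_on_iff_abs_summable_on_real[symmetric] summable_on_def
    by (simp add: mps_term_univar_has_sum_iff)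
  also have "\<dots> \<longleftrightarrow> summable (\<lambda>n. norm (c n * x i ^ n))"
    by (rule summable_on_UNIV_nonneg_real_iff) auto
  finally show ?thesis .
qed

lemma mps_eval_univar:
  assumes "summable (\<lambda>n. norm (c n * x i ^ n))" "(\<lambda>n. c n * x i ^ n) sums s"
  shows "mps_eval (mps_univar i c) x = s"
  unfolding mps_eval_def
  by (rule infsumI, unfold mps_term_univar_has_sum_iff, rule norm_summable_imp_has_sum) fact+

lemma mps_term_univar_poly_has_sum:
  "(mps_term (mps_univar i (poly.coeff p)) x has_sum poly p (x i)) UNIV"
proof -
  have "((\<lambda>n. poly.coeff p n * x i ^ n) has_sum poly p (x i)) {..degree p}"
    unfolding poly_altdef by (rule has_sum_finite) simp
  then show ?thesis
    unfolding mps_term_univar_has_sum_iff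
    by (rule iffD1[OF has_sum_cong_neutral, rotated -1]) (auto simp: coeff_eq_0)
qed

text \<open>An exponent vector supported in \<open>{0}\<close> is determined by its entry at 0.
  Hence elements of \<open>S 1\<close> may be treated as coefficient sequences.\<close>

lemma in_vars_1_eq_univar:
  assumes "in_vars 1 f"
  shows "f = mps_univar 0 (\<lambda>n. mps_nth f (Poly_Mapping.single 0 n))"
proof (rule mps_eqI)
  fix m
  have "m = Poly_Mapping.single 0 (Poly_Mapping.lookup m 0)" if "mps_nth f m \<noteq> 0"
  proof (rule poly_mapping_eqI)
    fix i
    have "Poly_Mapping.keys m \<subseteq> {0}"
      using assms that by (auto simp: in_vars_def)
    then show "Poly_Mapping.lookup m i =
        Poly_Mapping.lookup (Poly_Mapping.single 0 (Poly_Mapping.lookup m 0)) i"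
      by (cases "i = 0") (auto simp: Poly_Mapping.lookup_single in_keys_iff when_def)
  qed
  then show "mps_nth f m = mps_nth (mps_univar 0 (\<lambda>n. mps_nth f (Poly_Mapping.single 0 n))) m"
    by (auto simp: mps_nth_univar)
qed

lemma conv_series_1_univar_iff:
  "mps_univar 0 c \<in> conv_series 1 \<longleftrightarrow>
    (\<exists>r>0. \<forall>t. \<bar>t\<bar> < r \<longrightarrow> summable (\<lambda>n. norm (c n * t ^ n)))"
proof -
  have "in_vars 1 (mps_univar 0 c)"
    by (auto simp: in_vars_def mps_nth_univar split: if_splits)
  moreover have "(\<forall>x\<in>open_box 1 (\<lambda>_. ereal r). summable (\<lambda>n. norm (c n * x 0 ^ n))) \<longleftrightarrow>
      (\<forall>t. \<bar>t\<bar> < r \<longrightarrow> summable (\<lambda>n. norm (c n * t ^ n)))" for r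
  proof (intro iffI allI impI ballI)
    fix t :: real
    assume *: "\<forall>x\<in>open_box 1 (\<lambda>_. ereal r). summable (\<lambda>n. norm (c n * x 0 ^ n))" and "\<bar>t\<bar> < r"
    then have "(\<lambda>i. if i = 0 then t else 0) \<in> open_box 1 (\<lambda>_. ereal r)"
      by (auto simp: open_box_def real_space_def)
    from bspec[OF * this] show "summable (\<lambda>n. norm (c n * t ^ n))"
      by simp
  next
    fix x
    assume "\<forall>t. \<bar>t\<bar> < r \<longrightarrow> summable (\<lambda>n. norm (c n * t ^ n))" "x \<in> open_box 1 (\<lambda>_. ereal r)"
    then show "summable (\<lambda>n. norm (c n * x 0 ^ n))"
      by (simp add: open_box_def abs_less_iff)
  qed
  ultimately show ?thesis
    unfolding conv_series_def mem_Collect_eq summable_on_iff_abs_summable_on_real[symmetric]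
      mps_term_univar_summable_iff by (simp only: simp_thms)
qed

subsection \<open>Univariate real power series\<close>

text \<open>Convergence at the positive real points below \<open>\<eta>\<close> already bounds the
  complex radius. This makes complex function theory available for real series.\<close>

lemma fps_conv_radius_of_real_ge:
  assumes "\<And>t. \<bar>t\<bar> < \<eta> \<Longrightarrow> summable (\<lambda>n. norm (c n * t ^ n :: real))"
  shows "fps_conv_radius (Abs_fps (\<lambda>n. of_real (c n) :: complex)) \<ge> ereal \<eta>"
  unfolding fps_conv_radius_def
proof (rule conv_radius_geI_ex')
  fix t assume "0 < t" "ereal t < ereal \<eta>"
  then have "summable (\<lambda>n. c n * t ^ n)"
    by (intro summable_norm_cancel[OF assms]) auto
  then have "summable (\<lambda>n. of_real (c n * t ^ n) :: complex)"
    by (rule summable_of_real)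
  then show "summable (\<lambda>n. fps_nth (Abs_fps (\<lambda>n. of_real (c n) :: complex)) n * of_real t ^ n)"
    by simp
qed

text \<open>By the identity theorem, the complex sum of \<open>c\<close> and \<open>H\<close>
  coincide on a disc around 0, because they agree on a set accumulating at 0. Only real points have
  to be compared.\<close>

lemma fps_expansion_eq_of_real_powser:
  assumes "\<eta> > 0" and conv: "\<And>t. \<bar>t\<bar> < \<eta> \<Longrightarrow> summable (\<lambda>n. norm (c n * t ^ n :: real))"
    and "\<epsilon> > 0" and hol: "H holomorphic_on ball 0 \<epsilon>"
    and U: "0 islimpt U"
    and eq: "\<And>z. z \<in> U \<Longrightarrow> \<exists>t s. z = of_real t \<and> (\<lambda>n. c n * t ^ n) sums s \<and> H z = of_real s"
  shows "fps_expansion H 0 = Abs_fps (\<lambda>n. of_real (c n))"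
proof (rule fps_expansion_eqI)
  let ?F = "Abs_fps (\<lambda>n. of_real (c n) :: complex)"
  define \<rho> where "\<rho> = min \<epsilon> \<eta>"
  have "\<rho> > 0"
    using assms by (auto simp: \<rho>_def)
  have rad: "fps_conv_radius ?F \<ge> ereal \<eta>"
    using conv by (rule fps_conv_radius_of_real_ge)
  have sub: "norm z < fps_conv_radius ?F" if "z \<in> ball 0 \<rho>" for z :: complex
    by (rule less_le_trans[OF _ rad]) (use that in \<open>auto simp: \<rho>_def\<close>)
  have "eval_fps ?F w - H w = 0" if "w \<in> ball 0 \<rho>" for w
  proof (rule analytic_continuation[where f = "\<lambda>w. eval_fps ?F w - H w" and U = "U \<inter> ball 0 \<rho>"
        and S = "ball 0 \<rho>" and \<xi> = 0])
    show "(\<lambda>w. eval_fps ?F w - H w) holomorphic_on ball 0 \<rho>"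
    proof (intro holomorphic_intros)
      show "ball (0 :: complex) \<rho> \<subseteq> eball 0 (fps_conv_radius ?F)"
        using sub by (auto simp: in_eball_iff dist_norm)
      show "H holomorphic_on ball 0 \<rho>"
        by (rule holomorphic_on_subset[OF hol]) (auto simp: \<rho>_def)
    qed
    have "eventually (\<lambda>y. y \<in> ball 0 \<rho>) (at (0 :: complex))"
      using \<open>\<rho> > 0\<close> by (intro eventually_at_in_open') auto
    then show "0 islimpt U \<inter> ball 0 \<rho>"
      by (rule islimpt_Int_eventually[OF U])
    fix z assume z: "z \<in> U \<inter> ball 0 \<rho>"
    then obtain t s where t: "z = of_real t" "(\<lambda>n. c n * t ^ n) sums s" "H z = of_real s"
      using eq by blast
    have "(\<lambda>n. fps_nth ?F n * z ^ n) sums eval_fps ?F z"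
      using z sub by (intro sums_eval_fps) auto
    moreover have "(\<lambda>n. fps_nth ?F n * z ^ n) sums of_real s"
      using sums_of_real[OF t(2), where 'a = complex] t(1) by simp
    ultimately have "eval_fps ?F z = of_real s"
      by (rule sums_unique2)
    then show "eval_fps ?F z - H z = 0"
      using t(3) by simp
  qed (use that \<open>\<rho> > 0\<close> in auto)
  then have "eventually (\<lambda>w. eval_fps ?F w = H w) (nhds 0)"
    using \<open>\<rho> > 0\<close> by (intro eventually_mono[OF eventually_nhds_in_open[of "ball 0 \<rho>"]]) auto
  moreover have "fps_conv_radius ?F > 0"
    using \<open>\<eta> > 0\<close> by (intro less_le_trans[OF _ rad]) auto
  ultimately show "H has_fps_expansion ?F"
    by (simp add: has_fps_expansion_def)
qed

text \<open>Both sequences are coefficients of the complex sum of \<open>d\<close> at 0. The lemma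
  supplies the uniqueness needed for the definite description in \<open>mps_expand\<close>.\<close>

lemma real_powser_unique:
  fixes c d :: "nat \<Rightarrow> real"
  assumes "\<eta> > 0"
    and c: "\<And>t. \<bar>t\<bar> < \<eta> \<Longrightarrow> summable (\<lambda>n. norm (c n * t ^ n))"
    and d: "\<And>t. \<bar>t\<bar> < \<eta> \<Longrightarrow> summable (\<lambda>n. norm (d n * t ^ n))"
    and eq: "\<And>t. \<bar>t\<bar> < \<eta> \<Longrightarrow> suminf (\<lambda>n. c n * t ^ n) = suminf (\<lambda>n. d n * t ^ n)"
  shows "c = d"
proof -
  let ?D = "Abs_fps (\<lambda>n. of_real (d n) :: complex)"
  define U where "U = of_real ` {t. \<bar>t\<bar> < \<eta>} - {0 :: complex}"
  have "0 islimpt U"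
    unfolding islimpt_approachable
  proof (intro allI impI)
    fix e :: real assume "e > 0"
    define t where "t = min \<eta> e / 2"
    have "0 < t" "t < \<eta>" "t < e"
      using \<open>e > 0\<close> \<open>\<eta> > 0\<close> by (auto simp: t_def)
    then show "\<exists>z\<in>U. z \<noteq> 0 \<and> dist z 0 < e"
      by (intro bexI[of _ "of_real t"]) (auto simp: U_def)
  qed
  have rad: "fps_conv_radius ?D \<ge> ereal \<eta>"
    using d by (rule fps_conv_radius_of_real_ge)
  have hol: "eval_fps ?D holomorphic_on ball 0 \<eta>"
  proof (intro holomorphic_intros subsetI)
    fix z :: complex assume "z \<in> ball 0 \<eta>"
    then show "z \<in> eball 0 (fps_conv_radius ?D)"
      using less_le_trans[OF _ rad, of "ereal (norm z)"] by (simp add: in_eball_iff dist_norm)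
  qed
  have sums: "(\<lambda>n. b n * t ^ n) sums suminf (\<lambda>n. b n * t ^ n)"
    if "summable (\<lambda>n. norm (b n * t ^ n :: real))" for b t
    using that by (rule summable_sums[OF summable_norm_cancel])
  have evD: "eval_fps ?D (of_real t) = of_real (suminf (\<lambda>n. d n * t ^ n))" if "\<bar>t\<bar> < \<eta>" for t
    using sums_of_real[OF sums[OF d[OF that]], where 'a = complex]
    by (simp add: eval_fps_def sums_iff)
  \<comment> \<open>The claim is kept general in \<open>b\<close> in order to be applied to
    \<open>c\<close> and to \<open>d\<close>.\<close>
  have "fps_expansion (eval_fps ?D) 0 = Abs_fps (\<lambda>n. of_real (b n))"
    if b: "\<And>t. \<bar>t\<bar> < \<eta> \<Longrightarrow> summable (\<lambda>n. norm (b n * t ^ n :: real))"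
      "\<And>t. \<bar>t\<bar> < \<eta> \<Longrightarrow> suminf (\<lambda>n. b n * t ^ n) = suminf (\<lambda>n. d n * t ^ n)" for b
  proof (rule fps_expansion_eq_of_real_powser[OF \<open>\<eta> > 0\<close> b(1) \<open>\<eta> > 0\<close> hol \<open>0 islimpt U\<close>])
    fix z assume "z \<in> U"
    then obtain t where "z = of_real t" "\<bar>t\<bar> < \<eta>"
      by (auto simp: U_def)
    then show "\<exists>t s. z = of_real t \<and> (\<lambda>n. b n * t ^ n) sums s \<and> eval_fps ?D z = of_real s"
      using sums[OF b(1)[of t]] evD[of t] b(2)[of t] by (intro exI conjI) auto
  qed
  from this[of c] this[of d] have "Abs_fps (\<lambda>n. of_real (c n) :: complex) = ?D"
    using c d eq by simp
  then show ?thesis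
    by (simp add: fps_eq_iff fun_eq_iff)
qed

text \<open>The disc of radius \<open>\<epsilon> - \<bar>a\<bar>\<close> around \<open>a\<close>
  lies in the disc of radius \<open>\<epsilon>\<close> around 0, so the complex Taylor series at
  \<open>a\<close> converges there. Its sum is real at real points, so taking real parts of its
  coefficients yields \<open>d\<close>.\<close>

lemma real_powser_recenter:
  fixes c :: "nat \<Rightarrow> real"
  assumes conv: "\<And>t. \<bar>t\<bar> < \<epsilon> \<Longrightarrow> summable (\<lambda>n. norm (c n * t ^ n))"
  obtains d where "\<And>t. \<bar>t\<bar> < \<epsilon> - \<bar>a\<bar> \<Longrightarrow> summable (\<lambda>n. norm (d n * t ^ n))"
    and "\<And>t. \<bar>t\<bar> < \<epsilon> - \<bar>a\<bar> \<Longrightarrow> (\<lambda>n. d n * t ^ n) sums suminf (\<lambda>n. c n * (a + t) ^ n)"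
proof -
  let ?F = "Abs_fps (\<lambda>n. of_real (c n) :: complex)"
  define E where "E = fps_expansion (eval_fps ?F) (of_real a)"
  have rad: "fps_conv_radius ?F \<ge> ereal \<epsilon>"
    using conv by (rule fps_conv_radius_of_real_ge)
  have "eval_fps ?F holomorphic_on eball (of_real a) (ereal (\<epsilon> - \<bar>a\<bar>))"
  proof (intro holomorphic_intros subsetI)
    fix z :: complex assume "z \<in> eball (of_real a) (ereal (\<epsilon> - \<bar>a\<bar>))"
    then have "norm z < \<epsilon>"
      using norm_triangle_ineq[of "z - of_real a" "of_real a"]
      by (simp add: in_eball_iff dist_norm norm_minus_commute)
    then show "z \<in> eball 0 (fps_conv_radius ?F)"
      using less_le_trans[OF _ rad, of "ereal (norm z)"] by (simp add: in_eball_iff dist_norm)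
  qed
  then have radE: "fps_conv_radius E \<ge> ereal (\<epsilon> - \<bar>a\<bar>)"
    and evE: "norm z < \<epsilon> - \<bar>a\<bar> \<Longrightarrow> eval_fps E z = eval_fps ?F (of_real a + z)" for z
    unfolding E_def using conv_radius_fps_expansion eval_fps_expansion'[where z = z]
    by (metis, metis less_ereal.simps(1))
  show thesis
  proof
    fix t assume t: "\<bar>t\<bar> < \<epsilon> - \<bar>a\<bar>"
    then have t': "ereal (norm (of_real t :: complex)) < fps_conv_radius E"
      by (intro less_le_trans[OF _ radE]) auto
    show "summable (\<lambda>n. norm (Re (fps_nth E n) * t ^ n))"
    proof (rule summable_comparison_test'[OF norm_summable_fps[OF t']])
      fix n
      show "norm (norm (Re (fps_nth E n) * t ^ n)) \<le> norm (fps_nth E n * of_real t ^ n)"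
        by (simp add: norm_mult norm_power abs_mult power_abs mult_right_mono abs_Re_le_cmod)
    qed
    have "summable (\<lambda>n. c n * (a + t) ^ n)"
      using t by (intro summable_norm_cancel[OF conv]) auto
    from sums_of_real[OF summable_sums[OF this], where 'a = complex]
    have "eval_fps ?F (of_real a + of_real t) = of_real (suminf (\<lambda>n. c n * (a + t) ^ n))"
      by (simp add: eval_fps_def sums_iff)
    with sums_eval_fps[OF t'] evE[of "of_real t"] t
    have "(\<lambda>n. fps_nth E n * of_real t ^ n) sums of_real (suminf (\<lambda>n. c n * (a + t) ^ n))"
      by simp
    from sums_Re[OF this]
    show "(\<lambda>n. Re (fps_nth E n) * t ^ n) sums suminf (\<lambda>n. c n * (a + t) ^ n)"
      by (simp flip: of_real_power)
  qed
qed

section \<open>Complex local inverses and recentred one-variable series\<close>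

lemma poly_map_poly_of_real:
  "poly (map_poly of_real p) (of_real x) = (of_real (poly p x) :: complex)"
  by (induction p) (auto simp: map_poly_pCons)

text \<open>The radius \<open>\<epsilon>\<close> does not depend on \<open>b\<close>: every \<open>c\<close> is a translate of one complex local inverse
  of \<open>p\<close> at \<open>\<alpha>\<close>.\<close>

lemma inverse_powser_at_simple_root:
  fixes p :: "real poly"
  assumes root: "poly p \<alpha> = 0" and simple: "poly (pderiv p) \<alpha> \<noteq> 0"
  obtains \<delta> \<epsilon> where "\<delta> > 0"
    and "\<And>b. \<bar>b - \<alpha>\<bar> < \<delta> \<Longrightarrow> \<bar>poly p b\<bar> < \<epsilon>"
    and "\<And>b. \<bar>b - \<alpha>\<bar> < \<delta> \<Longrightarrow> poly (pderiv p) b \<noteq> 0"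
    and "\<And>b c \<eta>. \<lbrakk>\<bar>b - \<alpha>\<bar> < \<delta>; \<eta> > 0;
        \<forall>t. \<bar>t\<bar> < \<eta> \<longrightarrow> summable (\<lambda>n. norm (c n * t ^ n));
        \<forall>y. \<bar>y\<bar> < \<eta> \<longrightarrow> (\<lambda>n. c n * (poly p (b + y) - poly p b) ^ n) sums y\<rbrakk>
      \<Longrightarrow> (\<forall>t. \<bar>t\<bar> < \<epsilon> \<longrightarrow> summable (\<lambda>n. norm (c n * t ^ n))) \<and>
          (\<lambda>n. c n * (- poly p b) ^ n) sums (\<alpha> - b)"
proof -
  define P where "P = poly (map_poly of_real p :: complex poly)"
  have P_real: "P (of_real x) = of_real (poly p x)" for x
    by (simp add: P_def poly_map_poly_of_real)
  have holP: "P holomorphic_on A" for A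
    unfolding P_def by (intro holomorphic_intros)
  have "pderiv (map_poly of_real p :: complex poly) = map_poly of_real (pderiv p)"
    by (simp add: poly_eq_iff coeff_pderiv coeff_map_poly)
  then have derivP: "deriv P (of_real x) = of_real (poly (pderiv p) x)" for x
    unfolding P_def using DERIV_imp_deriv[OF poly_DERIV] by (metis poly_map_poly_of_real)
  \<comment> \<open>As \<alpha> is a simple root, the derivative of \<open>P\<close> does not vanish
    there and \<open>P\<close> is injective nearby; \<open>g\<close> below is its holomorphic
    inverse.\<close>
  obtain r where r: "r > 0" "inj_on P (ball (of_real \<alpha>) r)"
    using has_complex_derivative_locally_injective[OF holP[of UNIV] UNIV_I open_UNIV,
        where \<xi> = "of_real \<alpha>"] simple by (auto simp: derivP)
  obtain g where g: "g holomorphic_on P ` ball (of_real \<alpha>) r"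
    "\<And>z. z \<in> ball (of_real \<alpha>) r \<Longrightarrow> deriv P z * deriv g (P z) = 1"
    "\<And>z. z \<in> ball (of_real \<alpha>) r \<Longrightarrow> g (P z) = z"
    using holomorphic_has_inverse[OF holP open_ball r(2)] by metis
  have "open (P ` ball (of_real \<alpha>) r)"
    by (rule open_mapping_thm3[OF holP open_ball r(2)])
  moreover have "0 \<in> P ` ball (of_real \<alpha>) r"
    using r(1) P_real[of \<alpha>] root by (intro image_eqI[of _ _ "of_real \<alpha>"]) auto
  ultimately obtain \<epsilon>' where \<epsilon>': "\<epsilon>' > 0" "ball 0 \<epsilon>' \<subseteq> P ` ball (of_real \<alpha>) r"
    unfolding open_contains_ball by blast
  \<comment> \<open>Halving leaves room for the shift: if
    \<open>\<bar>poly p b\<bar> < \<epsilon>\<close>, the disc of radius \<open>\<epsilon>\<close>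
    around \<open>poly p b\<close> stays in \<open>ball 0 \<epsilon>'\<close>, where
    \<open>g\<close> is defined.\<close>
  define \<epsilon> where "\<epsilon> = \<epsilon>' / 2"
  have "\<epsilon> > 0"
    using \<epsilon>' by (simp add: \<epsilon>_def)
  have "isCont (poly p) \<alpha>"
    by simp
  then obtain \<delta>0 where \<delta>0: "\<delta>0 > 0" "\<And>b. \<bar>b - \<alpha>\<bar> < \<delta>0 \<Longrightarrow> \<bar>poly p b\<bar> < \<epsilon>"
    using \<open>\<epsilon> > 0\<close> root unfolding continuous_at_eps_delta dist_real_def by (metis diff_0_right)
  define \<delta> where "\<delta> = min r \<delta>0"
  have in_ball: "of_real b \<in> ball (of_real \<alpha> :: complex) r" if "\<bar>b - \<alpha>\<bar> < \<delta>" for b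
  proof -
    have "dist (of_real \<alpha> :: complex) (of_real b) = \<bar>b - \<alpha>\<bar>"
      by (simp add: dist_norm norm_minus_commute flip: of_real_diff)
    then show ?thesis
      using that by (simp add: \<delta>_def)
  qed
  show thesis
  proof
    show "\<delta> > 0"
      using r \<delta>0 by (simp add: \<delta>_def)
    fix b assume b: "\<bar>b - \<alpha>\<bar> < \<delta>"
    show pb: "\<bar>poly p b\<bar> < \<epsilon>"
      using b \<delta>0 by (simp add: \<delta>_def)
    show "poly (pderiv p) b \<noteq> 0"
      using g(2)[OF in_ball[OF b]] by (auto simp: derivP)
    fix c :: "nat \<Rightarrow> real" and \<eta> :: real
    assume "\<eta> > 0"
      and conv: "\<forall>t. \<bar>t\<bar> < \<eta> \<longrightarrow> summable (\<lambda>n. norm (c n * t ^ n))"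
      and inv: "\<forall>y. \<bar>y\<bar> < \<eta> \<longrightarrow> (\<lambda>n. c n * (poly p (b + y) - poly p b) ^ n) sums y"
    \<comment> \<open>\<open>H\<close> is \<open>g\<close> recentred at \<open>poly p b\<close>,
      hence a local inverse of \<open>q\<close> that is holomorphic on a disc independent of
      \<open>b\<close>. The aim is to recognise \<open>c\<close> as its Taylor coefficients.\<close>
    define H where "H = (\<lambda>z. g (of_real (poly p b) + z) - of_real b)"
    define q where "q = (\<lambda>y. poly p (b + y) - poly p b)"
    \<comment> \<open>For \<open>\<bar>y\<bar> < \<eta>'\<close> the hypothesis on \<open>c\<close>
      applies and \<open>b + y\<close> remains close enough to \<alpha> for \<open>g\<close> to
      invert \<open>P\<close>.\<close>
    define \<eta>' where "\<eta>' = min \<eta> (\<delta> - \<bar>b - \<alpha>\<bar>)"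
    have "\<eta>' > 0"
      using b \<open>\<eta> > 0\<close> by (simp add: \<eta>'_def)
    have holH: "H holomorphic_on ball 0 \<epsilon>"
    proof -
      have "(\<lambda>z. of_real (poly p b) + z) ` ball 0 \<epsilon> \<subseteq> ball (0 :: complex) \<epsilon>'"
      proof (rule image_subsetI)
        fix z :: complex assume "z \<in> ball 0 \<epsilon>"
        then show "of_real (poly p b) + z \<in> ball 0 \<epsilon>'"
          using pb norm_triangle_ineq[of "of_real (poly p b)" z] by (simp add: \<epsilon>_def)
      qed
      then have "(g \<circ> (\<lambda>z. of_real (poly p b) + z)) holomorphic_on ball 0 \<epsilon>"
        using \<epsilon>'(2) by (intro holomorphic_on_compose_gen[OF _ g(1)] holomorphic_intros) auto
      then show ?thesis
        unfolding H_def by (intro holomorphic_intros) (simp add: o_def)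
    qed
    have Hq: "H (of_real (q y)) = of_real y" if "\<bar>y\<bar> < \<eta>'" for y
    proof -
      have "\<bar>b + y - \<alpha>\<bar> < \<delta>"
        using that unfolding \<eta>'_def by linarith
      from g(3)[OF in_ball[OF this], unfolded P_real] show ?thesis
        by (simp add: H_def q_def)
    qed
    define U where "U = (\<lambda>y. complex_of_real (q y)) ` {y. \<bar>y\<bar> < \<eta>' \<and> y \<noteq> 0}"
    have "0 islimpt U"
      unfolding islimpt_approachable
    proof (intro allI impI)
      fix e :: real assume "e > 0"
      have "isCont q 0" "q 0 = 0"
        unfolding q_def by (auto intro!: continuous_intros)
      then obtain d where d: "d > 0" "\<And>y. \<bar>y\<bar> < d \<Longrightarrow> \<bar>q y\<bar> < e"
        using \<open>e > 0\<close> unfolding continuous_at_eps_delta dist_real_def by (metis diff_0_right)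
      define y where "y = min d \<eta>' / 2"
      have y: "0 < y" "\<bar>y\<bar> < d" "\<bar>y\<bar> < \<eta>'"
        using d(1) \<open>\<eta>' > 0\<close> by (auto simp: y_def)
      \<comment> \<open>Otherwise \<open>y = H 0 = 0\<close>.\<close>
      have "q y \<noteq> 0"
        using Hq[OF y(3)] Hq[of 0] \<open>q 0 = 0\<close> y(1) \<open>\<eta>' > 0\<close> by auto
      then show "\<exists>z\<in>U. z \<noteq> 0 \<and> dist z 0 < e"
        using y d(2)[of y] by (intro bexI[of _ "of_real (q y)"]) (auto simp: U_def)
    qed
    have "fps_expansion H 0 = Abs_fps (\<lambda>n. of_real (c n))"
    proof (rule fps_expansion_eq_of_real_powser
        [OF \<open>\<eta> > 0\<close> conv[rule_format] \<open>\<epsilon> > 0\<close> holH \<open>0 islimpt U\<close>])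
      fix z assume "z \<in> U"
      then obtain y where y: "z = of_real (q y)" "\<bar>y\<bar> < \<eta>'"
        by (auto simp: U_def)
      then have "(\<lambda>n. c n * q y ^ n) sums y"
        using inv by (simp add: q_def \<eta>'_def)
      then show "\<exists>t s. z = of_real t \<and> (\<lambda>n. c n * t ^ n) sums s \<and> H z = of_real s"
        using y Hq by blast
    qed
    moreover have "H holomorphic_on eball 0 (ereal \<epsilon>)"
      using holH by simp
    ultimately have rad: "fps_conv_radius (Abs_fps (\<lambda>n. of_real (c n) :: complex)) \<ge> ereal \<epsilon>"
      and ev: "norm z < \<epsilon> \<Longrightarrow> eval_fps (Abs_fps (\<lambda>n. of_real (c n))) z = H z" for z
      using conv_radius_fps_expansion[of H 0 "ereal \<epsilon>"] eval_fps_expansion'[of H 0 "ereal \<epsilon>" z]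
      by auto
    have rad': "ereal (norm (of_real t :: complex)) < fps_conv_radius (Abs_fps (\<lambda>n. of_real (c n) :: complex))"
      if "\<bar>t\<bar> < \<epsilon>" for t
      by (rule less_le_trans[OF _ rad]) (use that in auto)
    \<comment> \<open>The value is \<open>g 0 - b\<close>, and \<open>g 0\<close> is \<alpha>
      because \<open>P\<close> vanishes at \<alpha>.\<close>
    have "H (of_real (- poly p b)) = of_real (\<alpha> - b)"
      using g(3)[of "of_real \<alpha>"] r(1) P_real[of \<alpha>] root by (simp add: H_def)
    then have "(\<lambda>n. of_real (c n * (- poly p b) ^ n) :: complex) sums of_real (\<alpha> - b)"
      using sums_eval_fps[OF rad'[of "- poly p b"]] pb ev[of "of_real (- poly p b)"] by simp
    then have "(\<lambda>n. c n * (- poly p b) ^ n) sums (\<alpha> - b)"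
      unfolding sums_of_real_iff .
    moreover have "summable (\<lambda>n. norm (c n * t ^ n))" if "\<bar>t\<bar> < \<epsilon>" for t
      using norm_summable_fps[OF rad'[OF that]] by (simp add: norm_mult norm_power abs_mult power_abs)
    ultimately show "(\<forall>t. \<bar>t\<bar> < \<epsilon> \<longrightarrow> summable (\<lambda>n. norm (c n * t ^ n))) \<and>
        (\<lambda>n. c n * (- poly p b) ^ n) sums (\<alpha> - b)"
      by blast
  qed
qed

text \<open>Recentring provides a candidate for \<open>mps_expand\<close>, and uniqueness of power
  series identifies it. Its constant coefficient is its value at displacement 0.\<close>

lemma mps_nth_expand_univar_0:
  assumes conv: "\<And>t. \<bar>t\<bar> < \<epsilon> \<Longrightarrow> summable (\<lambda>n. norm (c n * t ^ n))" and a: "\<bar>a 0\<bar> < \<epsilon>"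
  shows "mps_nth (mps_expand 1 (mps_univar 0 c) a) 0 = suminf (\<lambda>n. c n * a 0 ^ n)"
proof -
  obtain d where d: "\<And>t. \<bar>t\<bar> < \<epsilon> - \<bar>a 0\<bar> \<Longrightarrow> summable (\<lambda>n. norm (d n * t ^ n))"
    "\<And>t. \<bar>t\<bar> < \<epsilon> - \<bar>a 0\<bar> \<Longrightarrow> (\<lambda>n. d n * t ^ n) sums suminf (\<lambda>n. c n * (a 0 + t) ^ n)"
    using real_powser_recenter[OF conv, where a = "a 0"] by blast
  have eval_c: "mps_eval (mps_univar 0 c) (\<lambda>i. a i + x i) = suminf (\<lambda>n. c n * (a 0 + x 0) ^ n)"
    if "\<bar>x 0\<bar> < \<epsilon> - \<bar>a 0\<bar>" for x
  proof (rule mps_eval_univar)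
    show *: "summable (\<lambda>n. norm (c n * (a 0 + x 0) ^ n))"
      using that by (intro conv) auto
    show "(\<lambda>n. c n * (a 0 + x 0) ^ n) sums suminf (\<lambda>n. c n * (a 0 + x 0) ^ n)"
      using * by (rule summable_sums[OF summable_norm_cancel])
  qed
  have box: "\<bar>x 0\<bar> < r" if "x \<in> open_box 1 (\<lambda>_. ereal r)" for x r
    using that by (auto simp: open_box_def abs_less_iff)
  have "mps_expand 1 (mps_univar 0 c) a = mps_univar 0 d"
    unfolding mps_expand_def
  proof (rule the_equality)
    have "mps_univar 0 d \<in> conv_series 1"
      unfolding conv_series_1_univar_iff using d(1) a by (intro exI[of _ "\<epsilon> - \<bar>a 0\<bar>"]) auto
    moreover have "mps_eval (mps_univar 0 d) x = mps_eval (mps_univar 0 c) (\<lambda>i. a i + x i)"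
      if "x \<in> open_box 1 (\<lambda>_. ereal (\<epsilon> - \<bar>a 0\<bar>))" for x
      using eval_c[of x] mps_eval_univar[of d x 0, OF d(1) d(2)] box[OF that] by simp
    ultimately show "mps_univar 0 d \<in> conv_series 1 \<and>
        (\<exists>r>0. \<forall>x\<in>open_box 1 (\<lambda>_. ereal r).
          mps_eval (mps_univar 0 d) x = mps_eval (mps_univar 0 c) (\<lambda>i. a i + x i))"
      using a by (intro conjI exI[of _ "\<epsilon> - \<bar>a 0\<bar>"]) auto
  next
    fix g
    assume "g \<in> conv_series 1 \<and> (\<exists>r>0. \<forall>x\<in>open_box 1 (\<lambda>_. ereal r).
        mps_eval g x = mps_eval (mps_univar 0 c) (\<lambda>i. a i + x i))"
    then obtain r where "r > 0" and g: "g \<in> conv_series 1"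
      and r: "\<And>x. x \<in> open_box 1 (\<lambda>_. ereal r) \<Longrightarrow>
        mps_eval g x = mps_eval (mps_univar 0 c) (\<lambda>i. a i + x i)"
      by auto
    define e where "e n = mps_nth g (Poly_Mapping.single 0 n)" for n
    have g_eq: "g = mps_univar 0 e"
      unfolding e_def using g by (intro in_vars_1_eq_univar) (simp add: conv_series_def)
    obtain r' where "r' > 0" and r': "\<And>t. \<bar>t\<bar> < r' \<Longrightarrow> summable (\<lambda>n. norm (e n * t ^ n))"
      using g unfolding g_eq conv_series_1_univar_iff by blast
    \<comment> \<open>On this common radius \<open>e\<close> and \<open>d\<close> converge and both
      evaluation identities hold.\<close>
    define \<eta> where "\<eta> = min (min r r') (\<epsilon> - \<bar>a 0\<bar>)"
    have "e = d"
    proof (rule real_powser_unique[of \<eta>])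
      show "\<eta> > 0"
        using \<open>r > 0\<close> \<open>r' > 0\<close> a by (simp add: \<eta>_def)
      fix t assume t: "\<bar>t\<bar> < \<eta>"
      show e': "summable (\<lambda>n. norm (e n * t ^ n))" and "summable (\<lambda>n. norm (d n * t ^ n))"
        using t by (auto intro!: d r' simp: \<eta>_def simp del: real_norm_def)
      let ?x = "\<lambda>i. if i = 0 then t else 0 :: real"
      have "?x \<in> open_box 1 (\<lambda>_. ereal r)"
        using t by (auto simp: open_box_def real_space_def \<eta>_def)
      from r[OF this] have "mps_eval g ?x = suminf (\<lambda>n. c n * (a 0 + t) ^ n)"
        using eval_c[of ?x] t by (simp add: \<eta>_def)
      moreover have "mps_eval g ?x = suminf (\<lambda>n. e n * t ^ n)"
        unfolding g_eq using e' summable_sums[OF summable_norm_cancel[OF e']]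
        by (intro mps_eval_univar) simp_all
      moreover have "suminf (\<lambda>n. d n * t ^ n) = suminf (\<lambda>n. c n * (a 0 + t) ^ n)"
        using t by (intro sums_unique[symmetric] d(2)) (simp add: \<eta>_def)
      ultimately show "suminf (\<lambda>n. e n * t ^ n) = suminf (\<lambda>n. d n * t ^ n)"
        by simp
    qed
    then show "g = mps_univar 0 d"
      by (simp add: g_eq)
  qed
  moreover have "d 0 = suminf (\<lambda>n. c n * a 0 ^ n)"
    using sums_unique2[OF powser_sums_zero[of d] d(2)[of 0]] a by simp
  ultimately show ?thesis
    using mps_nth_univar_single[of 0 d 0] by simp
qed

subsection \<open>Polynomials over a subfield\<close>

lemma subring_sum_in:
  assumes "is_subring k" "\<And>i. i \<in> A \<Longrightarrow> f i \<in> k"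
  shows "sum f A \<in> k"
  using assms by (induction A rule: infinite_finite_induct) (auto simp: is_subring_def)

lemma subring_power_in:
  assumes "is_subring k" "x \<in> k"
  shows "x ^ n \<in> k"
  using assms by (induction n) (auto simp: is_subring_def)

lemma subring_of_nat_in:
  assumes "is_subring k"
  shows "of_nat n \<in> k"
  using assms by (induction n) (auto simp: is_subring_def)

lemma subring_poly_in:
  assumes "is_subring k" "\<And>i. poly.coeff p i \<in> k" "x \<in> k"
  shows "poly p x \<in> k"
  unfolding poly_altdef using assms subring_power_in[OF assms(1,3)]
  by (intro subring_sum_in) (auto simp: is_subring_def)

lemma subring_coeff_pcompose_in:
  assumes k: "is_subring k" and p: "\<And>i. poly.coeff p i \<in> k" and q: "\<And>i. poly.coeff q i \<in> k"
  shows "poly.coeff (pcompose p q) i \<in> k"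
  using p
proof (induction p arbitrary: i)
  case 0
  then show ?case
    using k by (simp add: is_subring_def)
next
  case (pCons c p)
  have "poly.coeff p j \<in> k" for j
    using pCons.prems[of "Suc j"] by simp
  then have "poly.coeff (q * pcompose p q) i \<in> k"
    unfolding coeff_mult using pCons.IH q k by (intro subring_sum_in) (auto simp: is_subring_def)
  moreover have "poly.coeff [:c:] i \<in> k"
    using pCons.prems[of 0] k by (cases i) (auto simp: is_subring_def)
  ultimately show ?case
    using k by (simp add: pcompose_pCons is_subring_def)
qed

lemma subfield_Rats_subset:
  fixes k :: "real set"
  assumes "is_subfield k"
  shows "\<rat> \<subseteq> k"
proof
  fix x :: real assume "x \<in> \<rat>"
  then obtain a b where ab: "b > 0" "x = of_int a / of_int b"
    by (elim Rats_cases')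
  have k: "is_subring k"
    using assms by (simp add: is_subfield_def)
  have int: "of_int z \<in> k" for z
    using k subring_of_nat_in[OF k] by (cases z rule: int_cases2) (auto simp: is_subring_def)
  have "inverse (of_int b) \<in> k"
    using assms int[of b] ab by (auto simp: is_subfield_def)
  then show "x \<in> k"
    using int[of a] k by (auto simp: ab divide_inverse is_subring_def)
qed

text \<open>A polynomial of least degree with root \<open>\<alpha>\<close> cannot share this root with its derivative.\<close>

lemma exists_simple_root_poly:
  fixes \<alpha> :: real
  assumes k: "is_subring k" and p: "\<And>i. poly.coeff p i \<in> k" "p \<noteq> 0" "poly p \<alpha> = 0"
  obtains q where "\<And>i. poly.coeff q i \<in> k" "poly q \<alpha> = 0" "poly (pderiv q) \<alpha> \<noteq> 0"
proof -
  let ?Q = "\<lambda>q. (\<forall>i. poly.coeff q i \<in> k) \<and> q \<noteq> 0 \<and> poly q \<alpha> = 0"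
  obtain q where q: "?Q q" and min: "\<And>r. ?Q r \<Longrightarrow> degree q \<le> degree r"
    using ex_has_least_nat[of ?Q p degree] p by blast
  have deg: "degree q \<noteq> 0"
  proof
    assume "degree q = 0"
    then obtain a where "q = [:a:]"
      by (rule degree_eq_zeroE)
    then show False
      using q by simp
  qed
  have "poly (pderiv q) \<alpha> \<noteq> 0"
  proof
    assume "poly (pderiv q) \<alpha> = 0"
    moreover have "poly.coeff (pderiv q) i \<in> k" for i
      using k q subring_of_nat_in[OF k, of "Suc i"] by (simp add: coeff_pderiv is_subring_def)
    \<comment> \<open>Characteristic 0 enters here: a nonconstant polynomial has a nonzero
      derivative.\<close>
    moreover have "pderiv q \<noteq> 0"
      using deg by (simp add: pderiv_eq_0_iff)
    ultimately have "degree q \<le> degree (pderiv q)"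
      by (intro min) auto
    then show False
      using deg by (simp add: degree_pderiv)
  qed
  then show thesis
    using q that by blast
qed

text \<open>The intermediate value theorem applies once both signs occur. For positive leading
  coefficient, \<open>q\<close> is positive somewhere, and so is \<open>-q(-Y)\<close>, whose
  leading coefficient is the same by oddness of the degree.\<close>

lemma odd_degree_real_root:
  fixes p :: "real poly"
  assumes "odd (degree p)"
  shows "\<exists>x. poly p x = 0"
proof -
  have pos: "\<exists>x. poly q x > 0" if "lead_coeff q > 0" for q :: "real poly"
    using poly_pinfty_gt_lc[OF that] that by (meson less_le_trans order_refl)
  have root: "\<exists>x. poly q x = 0" if q: "odd (degree q)" "lead_coeff q > 0" for q :: "real poly"
  proof -
    have "lead_coeff (- pcompose q [:0, -1:]) > 0"
      using q lead_coeff_comp[of "[:0, -1:]" q] by simp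
    from pos[OF this] obtain y where y: "poly q (- y) < 0"
      by (auto simp: poly_pcompose)
    obtain x where x: "poly q x > 0"
      using pos[OF q(2)] by blast
    show ?thesis
      using poly_IVT[of "- y" x q] poly_IVT[of x "- y" q] x y
      by (metis less_asym linorder_less_linear mult_neg_pos mult_pos_neg)
  qed
  show ?thesis
  proof (cases "lead_coeff p > 0")
    case True
    then show ?thesis
      using root assms by blast
  next
    case False
    moreover have "lead_coeff p \<noteq> 0"
      using assms by auto
    ultimately have "lead_coeff p < 0"
      by linarith
    then show ?thesis
      using root[of "- p"] assms by simp
  qed
qed

subsection \<open>Convergent Weierstrass systems\<close>

lemma is_systemD:
  assumes "is_system S"
  shows "S n \<subseteq> conv_series n" "is_subring (S n)" "is_subfield (coeff_field S)"
    and "n \<ge> 1 \<Longrightarrow> polys_over (coeff_field S) n \<subseteq> S n"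
    and "n \<ge> 1 \<Longrightarrow> S n \<subseteq> conv_series_over (coeff_field S) n"
  using assms unfolding is_system_def by blast+

text \<open>The interval of radius \<open>\<epsilon>\<close> is itself one of the boxes whose union
  is the domain.\<close>

lemma mps_domain_1_univar:
  assumes conv: "\<And>t. \<bar>t\<bar> < \<epsilon> \<Longrightarrow> summable (\<lambda>n. norm (c n * t ^ n))"
    and a: "a \<in> real_space 1" "\<bar>a 0\<bar> < \<epsilon>"
  shows "a \<in> mps_domain 1 (mps_univar 0 c)"
proof -
  let ?R = "\<lambda>_. ereal \<epsilon>"
  have "a \<in> open_box 1 ?R"
    using a by (auto simp: open_box_def)
  moreover have "mps_term (mps_univar 0 c) x summable_on UNIV" if "x \<in> open_box 1 ?R" for x
    unfolding mps_term_univar_summable_iff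
    using that by (intro conv) (auto simp: open_box_def abs_less_iff)
  moreover have "\<forall>i<1. 0 < ?R i"
    using a by auto
  ultimately show ?thesis
    unfolding mps_domain_def summable_on_iff_abs_summable_on_real[symmetric] by blast
qed

lemma univar_poly_in_polys_over:
  assumes k: "is_subring k" "\<And>j. poly.coeff p j \<in> k" and "i < n"
  shows "mps_univar i (poly.coeff p) \<in> polys_over k n"
proof -
  have "{m. mps_nth (mps_univar i (poly.coeff p)) m \<noteq> 0} \<subseteq>
      Poly_Mapping.single i ` {..degree p}"
    by (auto simp: mps_nth_univar le_degree split: if_splits)
  then have "finite {m. mps_nth (mps_univar i (poly.coeff p)) m \<noteq> 0}"
    by (rule finite_subset) auto
  then show ?thesis
    using assms by (auto simp: polys_over_def in_vars_def coeffs_in_def mps_nth_univar is_subring_def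
        split: if_splits)
qed

text \<open>Dividing \<open>X\<^sub>2\<close> by \<open>q(X\<^sub>2) - X\<^sub>1\<close>, of order 1
  since the linear coefficient of \<open>q\<close> is nonzero, leaves a remainder free of
  \<open>X\<^sub>2\<close>. Substituting \<open>X\<^sub>1 = q(X\<^sub>2)\<close> shows that it
  inverts \<open>q\<close>.\<close>

lemma weierstrass_system_inverse_series:
  assumes W: "convergent_weierstrass_system S"
    and q: "\<And>i. poly.coeff q i \<in> coeff_field S" "poly.coeff q 0 = 0" "poly.coeff q 1 \<noteq> 0"
  obtains c \<eta> where "mps_univar 0 c \<in> S 1" "\<eta> > 0"
    and "\<And>t. \<bar>t\<bar> < \<eta> \<Longrightarrow> summable (\<lambda>n. norm (c n * t ^ n))"
    and "\<And>y. \<bar>y\<bar> < \<eta> \<Longrightarrow> (\<lambda>n. c n * poly q y ^ n) sums y"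
proof -
  let ?k = "coeff_field S"
  have sys: "is_system S"
    using W by (simp add: convergent_weierstrass_system_def convergent_system_def)
  have k: "is_subring ?k"
    using is_systemD(3)[OF sys] by (simp add: is_subfield_def)
  have in_S2: "mps_univar i (poly.coeff p) \<in> S 2" if "\<And>j. poly.coeff p j \<in> ?k" "i < 2" for p i
  proof -
    have "polys_over ?k 2 \<subseteq> S 2"
      by (rule is_systemD(4)[OF sys]) simp
    then show ?thesis
      using univar_poly_in_polys_over[OF k that] by blast
  qed
  define f where "f = mps_univar 1 (poly.coeff q) + mps_univar 0 (poly.coeff [:0, -1:])"
  have f_S: "f \<in> S 2"
  proof -
    have "poly.coeff [:0, -1:] j \<in> ?k" for j
      using k by (auto simp: is_subring_def coeff_pCons split: nat.split)
    moreover have "is_subring (S 2)"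
      by (rule is_systemD(2)[OF sys])
    ultimately show ?thesis
      unfolding f_def using in_S2[OF q(1), of 1] in_S2[of "[:0, -1:]" 0]
      by (simp add: is_subring_def)
  qed
  have Y_S: "mps_univar 1 (poly.coeff [:0, 1:]) \<in> S 2"
    using k by (intro in_S2) (auto simp: is_subring_def coeff_pCons split: nat.split)
  \<comment> \<open>Pure powers of the two variables meet only in the monomial 1, so
    \<open>-X\<^sub>1\<close> does not affect the coefficients that decide regularity in
    \<open>X\<^sub>2\<close>.\<close>
  have "Poly_Mapping.single (Suc 0) n \<in> range (Poly_Mapping.single 0) \<longleftrightarrow> n = 0" for n :: nat
  proof -
    have "n = 0" if "Poly_Mapping.single (Suc 0) n = Poly_Mapping.single 0 m" for m
      using arg_cong[OF that, of "\<lambda>m. Poly_Mapping.lookup m (Suc 0)"] by (simp add: lookup_single)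
    then show ?thesis
      by (auto intro: range_eqI[of _ _ 0])
  qed
  then have "regular_of_order 2 f 1"
    using q(2,3) mps_nth_univar_single[of 1 "poly.coeff q" 0]
    by (auto simp: regular_of_order_def f_def plus_mps.rep_eq mps_nth_univar)
  then obtain h r where h: "h \<in> S 2" and r: "r \<in> polys_in_last_var S 2 1"
    and div: "mps_univar 1 (poly.coeff [:0, 1:]) = f * h + r"
    using W f_S Y_S unfolding convergent_weierstrass_system_def by (metis one_le_numeral)
  \<comment> \<open>A remainder of degree below 1 consists of its single coefficient, which lies in
    \<open>S (2 - 1)\<close>.\<close>
  have r_S: "r \<in> S 1"
    using r by (auto simp: polys_in_last_var_def)
  have S1: "r \<in> conv_series 1" and S2: "h \<in> conv_series 2"
    using is_systemD(1)[OF sys] r_S h by blast+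
  define c where "c n = mps_nth r (Poly_Mapping.single 0 n)" for n
  have r_eq: "r = mps_univar 0 c"
    unfolding c_def using S1 by (intro in_vars_1_eq_univar) (simp add: conv_series_def)
  obtain \<rho> where "\<rho> > 0" and \<rho>: "\<And>t. \<bar>t\<bar> < \<rho> \<Longrightarrow> summable (\<lambda>n. norm (c n * t ^ n))"
    using S1 unfolding r_eq conv_series_1_univar_iff by blast
  obtain \<sigma> where "\<sigma> > 0"
    and \<sigma>: "\<And>x. x \<in> open_box 2 (\<lambda>_. ereal \<sigma>) \<Longrightarrow> mps_term h x summable_on UNIV"
    using S2 unfolding conv_series_def summable_on_iff_abs_summable_on_real[symmetric] by blast
  have "isCont (poly q) 0" "poly q 0 = 0"
    using q(2) by (auto simp: poly_0_coeff_0)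
  moreover have "min \<rho> \<sigma> > 0"
    using \<open>\<rho> > 0\<close> \<open>\<sigma> > 0\<close> by simp
  ultimately obtain \<delta> where "\<delta> > 0" and \<delta>: "\<And>y. \<bar>y\<bar> < \<delta> \<Longrightarrow> \<bar>poly q y\<bar> < min \<rho> \<sigma>"
    unfolding continuous_at_eps_delta by (metis dist_real_def diff_0_right)
  \<comment> \<open>The bound \<open>\<delta>\<close> controls \<open>q(y)\<close> for both
    \<open>r\<close> and \<open>h\<close>, \<open>\<sigma>\<close> keeps \<open>y\<close> in the box
    of \<open>h\<close>, and \<open>\<rho>\<close> gives convergence of \<open>c\<close> itself
    below \<open>\<eta>\<close>.\<close>
  define \<eta> where "\<eta> = min \<delta> (min \<rho> \<sigma>)"
  show thesis
  proof
    show "mps_univar 0 c \<in> S 1"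
      using r_S by (simp add: r_eq)
    show "\<eta> > 0"
      using \<open>\<delta> > 0\<close> \<open>\<rho> > 0\<close> \<open>\<sigma> > 0\<close> by (simp add: \<eta>_def)
    show "summable (\<lambda>n. norm (c n * t ^ n))" if "\<bar>t\<bar> < \<eta>" for t
      using that by (intro \<rho>) (simp add: \<eta>_def)
    fix y assume y: "\<bar>y\<bar> < \<eta>"
    \<comment> \<open>On the curve \<open>X\<^sub>1 = q(X\<^sub>2)\<close> the divisor vanishes, so the division reads \<open>y = r(q(y))\<close>.\<close>
    define x where "x i = (if i = 0 then poly q y else if i = 1 then y else 0)" for i :: nat
    have x: "x 0 = poly q y" "x (Suc 0) = y"
      by (simp_all add: x_def)
    have "x \<in> open_box 2 (\<lambda>_. ereal \<sigma>)"
      using y \<delta>[of y] by (auto simp: open_box_def real_space_def x_def \<eta>_def)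
    then obtain s where s: "(mps_term h x has_sum s) UNIV"
      using \<sigma> unfolding summable_on_def by blast
    have "summable (\<lambda>n. norm (c n * x 0 ^ n))"
      unfolding x using y \<delta>[of y] by (intro \<rho>) (simp add: \<eta>_def)
    then obtain t where t: "(mps_term r x has_sum t) UNIV"
      unfolding mps_term_univar_summable_iff[symmetric] r_eq[symmetric] summable_on_def by blast
    have "(mps_term f x has_sum 0) UNIV"
      using mps_term_has_sum_add[OF mps_term_univar_poly_has_sum[of 1 q x]
          mps_term_univar_poly_has_sum[of 0 "[:0, -1:]" x]] by (simp add: f_def x)
    from mps_term_has_sum_add[OF mps_term_has_sum_times[OF this s] t]
    have "(mps_term (mps_univar 1 (poly.coeff [:0, 1:])) x has_sum t) UNIV"
      unfolding div by simp
    then have "t = y"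
      using has_sum_unique[OF _ mps_term_univar_poly_has_sum[of 1 "[:0, 1:]" x]] by (simp add: x)
    then show "(\<lambda>n. c n * poly q y ^ n) sums y"
      using t by (intro has_sum_imp_sums) (simp add: r_eq mps_term_univar_has_sum_iff x)
  qed
qed

text \<open>The difference of \<alpha> and a nearby rational \<open>b\<close> is the value at
  \<open>- poly p b\<close> of an inverse series in \<open>S 1\<close>; recentring there turns this
  value into a coefficient.\<close>

lemma weierstrass_system_simple_root_in:
  assumes W: "convergent_weierstrass_system S"
    and p: "\<And>i. poly.coeff p i \<in> coeff_field S"
    and \<alpha>: "poly p \<alpha> = 0" "poly (pderiv p) \<alpha> \<noteq> 0"
  shows "\<alpha> \<in> coeff_field S"
proof -
  let ?k = "coeff_field S"
  have conv: "convergent_system S"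
    using W by (simp add: convergent_weierstrass_system_def)
  then have sys: "is_system S"
    by (simp add: convergent_system_def)
  then have field: "is_subfield ?k" and k: "is_subring ?k"
    using is_systemD(3) by (auto simp: is_subfield_def)
  show ?thesis
  proof (rule inverse_powser_at_simple_root[OF \<alpha>])
    fix \<delta> \<epsilon> :: real
    assume "\<delta> > 0"
      and small: "\<And>b. \<bar>b - \<alpha>\<bar> < \<delta> \<Longrightarrow> \<bar>poly p b\<bar> < \<epsilon>"
      and simple: "\<And>b. \<bar>b - \<alpha>\<bar> < \<delta> \<Longrightarrow> poly (pderiv p) b \<noteq> 0"
      and inv: "\<And>b c \<eta>. \<lbrakk>\<bar>b - \<alpha>\<bar> < \<delta>; \<eta> > 0;
          \<forall>t. \<bar>t\<bar> < \<eta> \<longrightarrow> summable (\<lambda>n. norm (c n * t ^ n));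
          \<forall>y. \<bar>y\<bar> < \<eta> \<longrightarrow> (\<lambda>n. c n * (poly p (b + y) - poly p b) ^ n) sums y\<rbrakk>
        \<Longrightarrow> (\<forall>t. \<bar>t\<bar> < \<epsilon> \<longrightarrow> summable (\<lambda>n. norm (c n * t ^ n))) \<and>
            (\<lambda>n. c n * (- poly p b) ^ n) sums (\<alpha> - b)"
    \<comment> \<open>Rationals are dense and lie in every subfield of the reals, so \<alpha> can be
      approximated from within \<open>?k\<close>.\<close>
    obtain b where "b \<in> \<rat>" "\<alpha> < b" "b < \<alpha> + \<delta>"
      using Rats_dense_in_real[of \<alpha> "\<alpha> + \<delta>"] \<open>\<delta> > 0\<close> by auto
    then have b: "b \<in> ?k" "\<bar>b - \<alpha>\<bar> < \<delta>"
      using subfield_Rats_subset[OF field] by auto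
    have pb: "poly p b \<in> ?k"
      by (rule subring_poly_in[OF k p b(1)])
    \<comment> \<open>Moving the base point to \<open>b\<close> keeps the coefficients in
      \<open>?k\<close>, removes the constant term and makes the derivative of \<open>p\<close> at
      \<open>b\<close> the linear coefficient.\<close>
    define q where "q = pcompose p [:b, 1:] - [:poly p b:]"
    have q_poly: "poly q y = poly p (b + y) - poly p b" for y
      by (simp add: q_def poly_pcompose)
    have q_in: "poly.coeff q i \<in> ?k" for i
    proof -
      have "poly.coeff (pcompose p [:b, 1:]) i \<in> ?k"
        using k b(1) by (intro subring_coeff_pcompose_in p)
          (auto simp: is_subring_def coeff_pCons split: nat.split)
      moreover have "- poly.coeff [:poly p b:] i \<in> ?k"
        using k pb by (auto simp: is_subring_def coeff_pCons split: nat.split)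
      ultimately show ?thesis
        using k unfolding is_subring_def q_def coeff_diff diff_conv_add_uminus[of "poly.coeff _ _"]
        by blast
    qed
    have q_0: "poly.coeff q 0 = 0"
      by (simp add: q_poly flip: poly_0_coeff_0)
    have q_1: "poly.coeff q 1 \<noteq> 0"
    proof -
      have "poly.coeff q 1 = poly (pderiv q) 0"
        by (simp add: poly_0_coeff_0 coeff_pderiv)
      also have "\<dots> = poly (pderiv p) b"
        by (simp add: q_def pderiv_diff pderiv_pcompose poly_pcompose pderiv_pCons)
      finally show ?thesis
        using simple[OF b(2)] by simp
    qed
    obtain c \<eta> where c: "mps_univar 0 c \<in> S 1" and "\<eta> > 0"
      and c_conv: "\<And>t. \<bar>t\<bar> < \<eta> \<Longrightarrow> summable (\<lambda>n. norm (c n * t ^ n))"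
      and c_inv: "\<And>y. \<bar>y\<bar> < \<eta> \<Longrightarrow> (\<lambda>n. c n * poly q y ^ n) sums y"
      using weierstrass_system_inverse_series[OF W q_in q_0 q_1] by blast
    \<comment> \<open>The radius \<open>\<eta>\<close> from the division depends on \<open>b\<close>
      and may not reach \<open>- poly p b\<close>; the uniform radius \<open>\<epsilon>\<close>
      does.\<close>
    have conv_\<epsilon>: "\<And>t. \<bar>t\<bar> < \<epsilon> \<Longrightarrow> summable (\<lambda>n. norm (c n * t ^ n))"
      and val: "(\<lambda>n. c n * (- poly p b) ^ n) sums (\<alpha> - b)"
      using inv[OF b(2) \<open>\<eta> > 0\<close>] c_conv c_inv unfolding q_poly by blast+
    define a where "a i = (if i = 0 then - poly p b else 0)" for i :: nat
    have a: "a \<in> real_space 1" "\<bar>a 0\<bar> < \<epsilon>"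
      using small[OF b(2)] by (auto simp: a_def real_space_def)
    have "\<forall>i<1. a i \<in> ?k"
      using pb k by (auto simp: a_def is_subring_def)
    \<comment> \<open>Closure of a convergent system under recentring at points over
      \<open>?k\<close> enters here.\<close>
    then have "mps_expand 1 (mps_univar 0 c) a \<in> S 1"
      using conv c mps_domain_1_univar[OF conv_\<epsilon> a] by (auto simp: convergent_system_def)
    moreover have "S 1 \<subseteq> conv_series_over ?k 1"
      by (rule is_systemD(5)[OF sys]) simp
    ultimately have "mps_nth (mps_expand 1 (mps_univar 0 c) a) 0 \<in> ?k"
      by (auto simp: conv_series_over_def coeffs_in_def)
    moreover have "mps_nth (mps_expand 1 (mps_univar 0 c) a) 0 = \<alpha> - b"
      using mps_nth_expand_univar_0[where a = a, OF conv_\<epsilon> a(2)] val by (simp add: a_def sums_iff)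
    ultimately have "(\<alpha> - b) + b \<in> ?k"
      using k b(1) unfolding is_subring_def by metis
    then show ?thesis
      by simp
  qed
qed

section \<open>Real closedness from algebraic closedness in the reals\<close>

theorem theorem1p16:
  fixes S :: "nat \<Rightarrow> mps set"
  assumes "convergent_weierstrass_system S"
  shows "real_closed (coeff_field S)"
proof -
  let ?k = "coeff_field S"
  have field: "is_subfield ?k"
    using assms is_systemD(3)
    by (auto simp: convergent_weierstrass_system_def convergent_system_def)
  then have k: "is_subring ?k"
    by (simp add: is_subfield_def)
  \<comment> \<open>Relative algebraic closedness reduces both remaining conditions to exhibiting a
    real root of a nonzero polynomial over \<open>?k\<close>.\<close>
  have closed: "x \<in> ?k" if "\<And>i. poly.coeff p i \<in> ?k" "p \<noteq> 0" "poly p x = 0" for p x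
    using exists_simple_root_poly[OF k that] weierstrass_system_simple_root_in[OF assms] by blast
  have "\<exists>b\<in>?k. a = b\<^sup>2" if "a \<in> ?k" "0 \<le> a" for a
  proof (rule bexI)
    show "a = (sqrt a)\<^sup>2"
      using that by simp
    have "poly.coeff [:- a, 0, 1:] i \<in> ?k" for i
      using k that by (auto simp: is_subring_def coeff_pCons split: nat.split)
    then show "sqrt a \<in> ?k"
      by (rule closed) (use that in auto)
  qed
  moreover have "\<exists>x\<in>?k. poly p x = 0" if "\<forall>i. poly.coeff p i \<in> ?k" "odd (degree p)" for p
    using odd_degree_real_root[OF that(2)] closed[of p] that by (metis degree_0 even_zero)
  ultimately show ?thesis
    using field by (auto simp: real_closed_def)
qed

end
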